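(* Let $q$ be an odd prime power and let $C\subseteq\mathbb{F}_q^N$ be a linear code. Then $$\mathrm{QR}_C(X,Y,Z)=\frac{1}{|C^\perp|}\,\mathrm{QR}_{C^\perp}(X',Y',Z'),$$ where $$X'=X+\frac{q-1}{2}(Y+Z),\qquad Y'=X+\frac{-(Y+Z)+\epsilon_q\sqrt q\,(Y-Z)}{2},\qquad Z'=X+\frac{-(Y+Z)+\epsilon_q\sqrt q\,(Z-Y)}{2},$$ and $\epsilon_q=1$ if $q\equiv1\pmod4$, $\epsilon_q=i$ (the imaginary unit) if $q\equiv3\pmod 4$.
   Context: The dual code is $C^\perp=\{y\in\mathbb{F}_q^N : \sum_{i=1}^N x_iy_i=0 \text{ for all } x\in C\}$. The quadratic residue weight enumerator of a code $C\subseteq\mathbb{F}_q^N$ is $\mathrm{QR}_C(X,Y,Z)=\sum_{c\in C}X^{N-\mathrm{wt}(c)}Y^{\mathrm{res}(c)}Z^{\mathrm{nres}(c)}$, where $\mathrm{wt}(c)$ is the number of non-zero coordinates of $c$, $\mathrm{res}(c)$ is the number of coordinates that are non-zero squares in $\mathbb{F}_q$, and $\mathrm{nres}(c)$ is the number of coordinates that are not squares. *)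

theory Defs
  imports
    "HOL-Analysis.Analysis"
    "HOL-Computational_Algebra.Nth_Powers"
    "HOL-Number_Theory.Prime_Powers"
    "HOL-Library.Poly_Mapping"
begin

definition dual_code :: "('a::field ^ 'n) set \<Rightarrow> ('a ^ 'n) set" where
  "dual_code C = {y. \<forall>x\<in>C. (\<Sum>i\<in>UNIV. x $ i * y $ i) = 0}"

definition hamming_weight :: "'a::field ^ 'n \<Rightarrow> nat" where
  "hamming_weight c = card {i. c $ i \<noteq> 0}"

definition res_count :: "'a::field ^ 'n \<Rightarrow> nat" where
  "res_count c = card {i. c $ i \<noteq> 0 \<and> is_square (c $ i)}"

definition nres_count :: "'a::field ^ 'n \<Rightarrow> nat" where
  "nres_count c = card {i. \<not> is_square (c $ i)}"

(* The ambient commutative ring 'r is left open, so that the same expression serves both as the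
   polynomial itself (at the indeterminates) and as the result of substituting into it. *)
definition qr_enumerator ::
    "('a::field ^ 'n) set \<Rightarrow> 'r::comm_semiring_1 \<Rightarrow> 'r \<Rightarrow> 'r \<Rightarrow> 'r" where
  "qr_enumerator C X Y Z =
     (\<Sum>c\<in>C. X ^ (CARD('n) - hamming_weight c) * Y ^ res_count c * Z ^ nres_count c)"

(* The polynomial ring over the complex numbers in three indeterminates: finitely supported maps
   from exponent vectors to coefficients, with convolution as multiplication. *)
datatype qr_var = VarX | VarY | VarZ

type_synonym qr_poly = "(qr_var \<Rightarrow>\<^sub>0 nat) \<Rightarrow>\<^sub>0 complex"

definition const_poly :: "complex \<Rightarrow> qr_poly" where
  "const_poly a = Poly_Mapping.single 0 a"

definition var_poly :: "qr_var \<Rightarrow> qr_poly" where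
  "var_poly v = Poly_Mapping.single (Poly_Mapping.single v 1) 1"

(* Used only for odd q, where the second case is q = 3 modulo 4. *)
definition gauss_sign :: "nat \<Rightarrow> complex" where
  "gauss_sign q = (if q mod 4 = 1 then 1 else \<i>)"

end

theory Submission
  imports Defs "HOL-Number_Theory.Residues"
begin

text \<open>
  The enumerator is a sum over codewords of a product of one-coordinate weights: a coordinate
  contributes \<open>X\<close>, \<open>Y\<close> or \<open>Z\<close> according to whether it is zero, a non-zero square or a non-square.
  For any weight of this product form, expanding the product and summing an additive character
  over the dual code gives the MacWilliams identity: the sum of the Fourier-transformed weights
  over the dual code is the size of the dual code times the sum of the weights over the code
  (lemma \<open>macwilliams_product_weight\<close>). It rests on orthogonality of characters on subspaces and on
  the code being its own double dual; the latter follows by counting, since orthogonality also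
  gives that the sizes of a code and of its dual multiply to the size of the ambient space.

  It remains to compute the Fourier transform of the one-coordinate weight
  (lemma \<open>fourier_qr_weight\<close>). The weight is a combination of the constant function, the indicator of
  zero and the quadratic character, so the transform is expressed by the quadratic Gauss sum
  \<open>G\<close>. The square of \<open>G\<close> is \<open>q\<close> times the value of the quadratic character at \<open>- 1\<close>, which determines
  \<open>G\<close> up to sign. The sign need not be determined: replacing the additive character \<open>\<psi>\<close> by
  \<open>\<lambda>x. \<psi> (a * x)\<close> for a non-square \<open>a\<close> negates \<open>G\<close>, and the MacWilliams identity holds for every
  nontrivial \<open>\<psi>\<close>.
\<close>

section \<open>Additive characters of a finite field\<close>

text \<open>
  A nontrivial homomorphism from the additive group of the field to the multiplicative group of
  the complex numbers. The condition \<open>\<psi> 0 = 1\<close> excludes the zero function.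
\<close>
definition nontrivial_add_char :: "('a::field \<Rightarrow> complex) \<Rightarrow> bool" where
  "nontrivial_add_char \<psi> \<longleftrightarrow> (\<forall>x y. \<psi> (x + y) = \<psi> x * \<psi> y) \<and> (\<exists>x. \<psi> x \<noteq> 1) \<and> \<psi> 0 = 1"

text \<open>
  The prime field has a complementary additive subgroup \<open>H\<close>: an additive subgroup that is maximal among
  those not containing \<open>1\<close>. The quotient by \<open>H\<close> is cyclic of order \<open>p\<close>, generated by \<open>1\<close>, and so
  carries a nontrivial character; this replaces the use of the field trace.
\<close>
lemma ex_additive_complement_of_prime_field:
  fixes p :: nat
  assumes "p = CHAR('a::{field,finite})"
  obtains H :: "'a::{field,finite} set" where
    "0 \<in> H" "\<And>x y. x \<in> H \<Longrightarrow> y \<in> H \<Longrightarrow> x + y \<in> H" "\<And>x. x \<in> H \<Longrightarrow> - x \<in> H"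
    "\<And>k. of_nat k \<in> H \<Longrightarrow> p dvd k" "\<And>x. \<exists>k. x - of_nat k \<in> H"
proof -
  have p: "prime p"
    unfolding assms using finite_imp_CHAR_pos[where 'a='a] prime_CHAR_semidom[where 'a='a] by simp
  \<comment> \<open>In positive characteristic, a set that contains 0 and is closed under addition is a subgroup.\<close>
  define closed where "closed = (\<lambda>H :: 'a set. 0 \<in> H \<and> (\<forall>x\<in>H. \<forall>y\<in>H. x + y \<in> H))"
  have fin: "finite {H :: 'a set. closed H \<and> 1 \<notin> H}"
    by simp
  have mem: "{0} \<in> {H :: 'a set. closed H \<and> 1 \<notin> H}"
    by (simp add: closed_def)
  obtain H where "H \<in> {H :: 'a set. closed H \<and> 1 \<notin> H}"
    and "\<forall>H' \<in> {H :: 'a set. closed H \<and> 1 \<notin> H}. H \<subseteq> H' \<longrightarrow> H = H'"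
    using finite_has_maximal2[OF fin mem] by (elim bexE conjE) (rule that)
  then have H: "closed H" "1 \<notin> H"
    and max: "\<And>H'. closed H' \<Longrightarrow> 1 \<notin> H' \<Longrightarrow> H \<subseteq> H' \<Longrightarrow> H = H'"
    by simp_all
  have add: "x + y \<in> H" if "x \<in> H" "y \<in> H" for x y
    using H that by (auto simp: closed_def)
  have zero: "0 \<in> H"
    using H by (auto simp: closed_def)
  have mult: "of_nat n * x \<in> H" if "x \<in> H" for n x
    using that by (induction n) (auto simp: algebra_simps zero add)
  have neg: "- x \<in> H" if "x \<in> H" for x
  proof -
    have "of_nat (p - 1) = (-1 :: 'a)"
      using prime_gt_0_nat[OF p] by (simp add: of_nat_diff assms)
    then show ?thesis
      using mult[OF that, of "p - 1"] by simp
  qed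
  have inv: "\<exists>m. of_nat m * of_nat n = (1 :: 'a)" if "\<not> p dvd n" for n
  proof -
    have "coprime n p"
      using prime_imp_coprime[OF p that] by (simp add: coprime_commute)
    then obtain m where "[n * m = 1] (mod p)"
      using cong_solve_coprime_nat by auto
    then have "of_nat (n * m) = (of_nat 1 :: 'a)"
      unfolding assms by (simp only: of_nat_eq_iff_cong_CHAR)
    then show ?thesis
      by (auto simp: mult.commute)
  qed
  have dvd: "p dvd k" if "of_nat k \<in> H" for k
    using inv[of k] mult[OF that] H(2) by metis
  have rep: "\<exists>k. x - of_nat k \<in> H" for x
  proof (cases "x \<in> H")
    case True
    then show ?thesis
      by (intro exI[of _ 0]) simp
  next
    case False
    \<comment> \<open>The subgroup generated by \<open>H\<close> and \<open>x\<close> contains 1 by maximality; solve for \<open>x\<close> modulo \<open>H\<close>.\<close>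
    define H' where "H' = {h + of_nat n * x | h n. h \<in> H}"
    have "h + of_nat n * x \<in> H'" if "h \<in> H" for h n
      unfolding H'_def using that by blast
    from this[of _ 0] this[of 0 1] zero have sub: "H \<subseteq> H'" and x: "x \<in> H'"
      by auto
    have "closed H'"
      unfolding closed_def
    proof (intro conjI ballI)
      show "0 \<in> H'"
        using sub zero by blast
    next
      fix a b assume "a \<in> H'" "b \<in> H'"
      then obtain h n h' n' where "a = h + of_nat n * x" "b = h' + of_nat n' * x" "h \<in> H" "h' \<in> H"
        unfolding H'_def by blast
      then show "a + b \<in> H'"
        unfolding H'_def using add
        by (auto intro!: exI[of _ "h + h'"] exI[of _ "n + n'"] simp: algebra_simps)
    qed
    then have "1 \<in> H'"
      using max[of H'] sub x False by blast
    then obtain h n where hn: "1 = h + of_nat n * x" "h \<in> H"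
      unfolding H'_def by blast
    have "\<not> p dvd n"
    proof
      assume "p dvd n"
      then have "(of_nat n :: 'a) = 0"
        by (simp add: of_nat_eq_0_iff_char_dvd assms)
      then show False
        using hn H by simp
    qed
    then obtain m where m: "of_nat m * of_nat n = (1 :: 'a)"
      using inv by blast
    have "of_nat m = of_nat m * (h + of_nat n * x)"
      using arg_cong[OF hn(1), of "\<lambda>z. of_nat m * z"] by simp
    also have "\<dots> = of_nat m * h + x"
      using m by (simp add: distrib_left flip: mult.assoc)
    finally have "x - of_nat m = - (of_nat m * h)"
      by (simp add: algebra_simps)
    then show ?thesis
      using neg mult hn by metis
  qed
  show ?thesis
    by (rule that) (use zero add neg dvd rep in auto)
qed

lemma ex_nontrivial_add_char: "\<exists>\<psi> :: 'a::{field,finite} \<Rightarrow> complex. nontrivial_add_char \<psi>"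
proof -
  define p where "p = CHAR('a)"
  have p: "prime p"
    unfolding p_def using finite_imp_CHAR_pos[where 'a='a] prime_CHAR_semidom[where 'a='a] by simp
  obtain H :: "'a set" where zero: "0 \<in> H"
    and add: "\<And>x y. x \<in> H \<Longrightarrow> y \<in> H \<Longrightarrow> x + y \<in> H" and neg: "\<And>x. x \<in> H \<Longrightarrow> - x \<in> H"
    and dvd: "\<And>k. of_nat k \<in> H \<Longrightarrow> p dvd k" and rep: "\<And>x. \<exists>k. x - of_nat k \<in> H"
    using ex_additive_complement_of_prime_field[OF p_def] by metis
  have "card {z :: complex. z ^ p = 1} = p"
    using card_roots_unity_eq[of p] prime_gt_0_nat[OF p] by simp
  then have "{z :: complex. z ^ p = 1} \<noteq> {1}"
    using prime_gt_1_nat[OF p] by auto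
  then obtain \<omega> :: complex where \<omega>: "\<omega> ^ p = 1" "\<omega> \<noteq> 1"
    by auto
  have per_le: "\<omega> ^ l = \<omega> ^ k" if "of_nat k - of_nat l \<in> H" "l \<le> k" for k l
  proof -
    have "p dvd k - l"
      using that dvd[of "k - l"] by (simp add: of_nat_diff)
    then obtain d where "k - l = p * d" ..
    then have "k = l + p * d"
      using that by simp
    then show ?thesis
      by (simp add: power_add power_mult \<omega>)
  qed
  have per: "\<omega> ^ k = \<omega> ^ l" if "of_nat k - of_nat l \<in> H" for k l
  proof (cases "l \<le> k")
    case True
    then show ?thesis
      using per_le[of k l] that by simp
  next
    case False
    then show ?thesis
      using per_le[of l k] neg[OF that] by simp
  qed
  \<comment> \<open>The character sends \<open>x\<close> to \<open>\<omega> ^ k\<close> for any \<open>k\<close> representing \<open>x\<close> modulo \<open>H\<close>.\<close>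
  define \<kappa> where "\<kappa> = (\<lambda>x. SOME k. x - of_nat k \<in> H)"
  have \<kappa>: "x - of_nat (\<kappa> x) \<in> H" for x
    using someI_ex[OF rep[of x]] by (simp add: \<kappa>_def)
  have char: "\<omega> ^ \<kappa> x = \<omega> ^ k" if "x - of_nat k \<in> H" for x k
  proof (rule per)
    show "of_nat (\<kappa> x) - of_nat k \<in> H"
      using add[OF that neg[OF \<kappa>[of x]]] by simp
  qed
  have "\<omega> ^ \<kappa> (x + y) = \<omega> ^ \<kappa> x * \<omega> ^ \<kappa> y" for x y
    using char[of "x + y" "\<kappa> x + \<kappa> y"] add[OF \<kappa>[of x] \<kappa>[of y]]
    by (simp add: power_add algebra_simps)
  moreover have "\<omega> ^ \<kappa> 0 = 1"
    using char[of 0 0] zero by simp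
  moreover have "\<omega> ^ \<kappa> 1 \<noteq> 1"
    using char[of 1 1] zero \<omega> by simp
  ultimately have "nontrivial_add_char (\<lambda>x. \<omega> ^ \<kappa> x)"
    unfolding nontrivial_add_char_def by blast
  then show ?thesis by blast
qed

text \<open>The averaging argument behind all orthogonality relations below.\<close>
lemma sum_eq_0_if_scaled_by_bij:
  fixes f :: "'b \<Rightarrow> complex"
  assumes "bij_betw g D D" and "\<And>y. y \<in> D \<Longrightarrow> f (g y) = u * f y" and "u \<noteq> 1"
  shows "sum f D = 0"
proof -
  have "sum f D = (\<Sum>y\<in>D. f (g y))"
    using sum.reindex_bij_betw[OF assms(1), of f] by simp
  also have "\<dots> = u * sum f D"
    using assms(2) by (simp add: sum_distrib_left)
  finally show ?thesis
    using assms(3) by simp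
qed

lemma nontrivial_add_char_scale:
  assumes "nontrivial_add_char \<psi>" and "a \<noteq> 0"
  shows "nontrivial_add_char (\<lambda>x. \<psi> (a * x))"
proof -
  obtain x where "\<psi> x \<noteq> 1"
    using assms unfolding nontrivial_add_char_def by blast
  then have "\<psi> (a * (x / a)) \<noteq> 1"
    using assms by simp
  then show ?thesis
    using assms unfolding nontrivial_add_char_def by (auto simp: distrib_left simp del: times_divide_eq_right)
qed

lemma sum_nontrivial_add_char:
  fixes \<psi> :: "'a::{field,finite} \<Rightarrow> complex"
  assumes "nontrivial_add_char \<psi>"
  shows "(\<Sum>x\<in>UNIV. \<psi> (x * a)) = (if a = 0 then of_nat CARD('a) else 0)"
proof (cases "a = 0")
  case True
  then show ?thesis
    using assms by (simp add: nontrivial_add_char_def)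
next
  case False
  have c: "nontrivial_add_char (\<lambda>x. \<psi> (a * x))"
    by (rule nontrivial_add_char_scale[OF assms False])
  then obtain t where t: "\<psi> (a * t) \<noteq> 1"
    unfolding nontrivial_add_char_def by blast
  have "bij (\<lambda>x :: 'a. t + x)"
    by simp
  then have "(\<Sum>x\<in>UNIV. \<psi> (a * x)) = 0"
    by (rule sum_eq_0_if_scaled_by_bij[where u = "\<psi> (a * t)"])
      (use c t in \<open>auto simp: nontrivial_add_char_def\<close>)
  then show ?thesis
    using False by (simp add: mult.commute)
qed

section \<open>Squares in a finite field of odd order\<close>

lemma card_finite_field_gt_1: "1 < CARD('a::{field,finite})"
proof -
  have "card {0, 1 :: 'a} \<le> CARD('a)"
    by (rule card_mono) auto
  then show ?thesis
    by simp
qed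

lemma finite_field_power_card_minus_one:
  fixes y :: "'a::{field,finite}"
  assumes "y \<noteq> 0"
  shows "y ^ (CARD('a) - 1) = 1"
proof -
  have "bij_betw (\<lambda>x. y * x) (UNIV - {0}) (UNIV - {0})"
    by (rule bij_betwI[where g = "\<lambda>x. x / y"]) (use assms in auto)
  then have "\<Prod>(UNIV - {0 :: 'a}) = (\<Prod>x\<in>UNIV - {0}. y * x)"
    using prod.reindex_bij_betw[of "\<lambda>x. y * x" _ _ "\<lambda>x. x"] by metis
  also have "\<dots> = y ^ (CARD('a) - 1) * \<Prod>(UNIV - {0})"
    by (simp add: prod.distrib card_Diff_singleton)
  finally show ?thesis
    by simp
qed

lemma one_neq_minus_one_if_odd_card:
  assumes "odd CARD('a::{field,finite})"
  shows "(1 :: 'a) \<noteq> - 1"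
proof
  assume "(1 :: 'a) = - 1"
  then have "of_nat 2 = (0 :: 'a)"
    by (metis add.right_inverse of_nat_numeral one_add_one)
  then have "CHAR('a) dvd 2"
    by (simp only: of_nat_eq_0_iff_char_dvd)
  then have "CHAR('a) = 2"
    using CHAR_not_1'[where 'a='a] two_is_prime_nat unfolding prime_nat_iff by force
  then show False
    using CHAR_dvd_CARD[where 'a='a] assms by simp
qed

lemma card_power_eq_one_le:
  assumes "0 < m"
  shows "card {x :: 'a::{field,finite}. x ^ m = 1} \<le> m"
proof -
  define P where "P = Polynomial.monom (1 :: 'a) m + [:- 1:]"
  have deg: "degree P = m"
    unfolding P_def using assms degree_add_eq_left[of "[:- 1:]" "Polynomial.monom (1 :: 'a) m"]
    by (simp add: degree_monom_eq)
  then have "P \<noteq> 0"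
    using assms by auto
  moreover have "poly P x = 0 \<longleftrightarrow> x ^ m = 1" for x
    by (simp add: P_def poly_monom)
  ultimately show ?thesis
    using card_poly_roots_bound[of P] deg by simp
qed

text \<open>
  Euler's criterion. Squaring is at most two-to-one, so there are at least \<open>(q - 1) / 2\<close> non-zero
  squares; they are all roots of \<open>x ^ ((q - 1) / 2) = 1\<close>, which has at most that many.
\<close>
lemma is_square_iff_euler:
  fixes x :: "'a::{field,finite}"
  assumes "odd CARD('a)" and "x \<noteq> 0"
  shows "is_square x \<longleftrightarrow> x ^ ((CARD('a) - 1) div 2) = 1"
proof -
  define m where "m = (CARD('a) - 1) div 2"
  have card: "CARD('a) - 1 = 2 * m"
    unfolding m_def using assms by simp
  have m: "0 < m"
    using card card_finite_field_gt_1[where 'a='a] by simp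
  define S where "S = (\<lambda>x :: 'a. x ^ 2) ` (UNIV - {0})"
  have sub: "S \<subseteq> {x. x ^ m = 1}"
  proof
    fix s assume "s \<in> S"
    then obtain y where "y \<noteq> 0" "s = y ^ 2"
      unfolding S_def by auto
    then show "s \<in> {x. x ^ m = 1}"
      using finite_field_power_card_minus_one[of y] card by (simp flip: power_mult)
  qed
  have fib: "card {y \<in> UNIV - {0}. y ^ 2 = s} \<le> 2" for s :: 'a
  proof (cases "\<exists>y. y ^ 2 = s")
    case True
    then obtain y where "s = y ^ 2"
      by blast
    then have "{y \<in> UNIV - {0}. y ^ 2 = s} \<subseteq> {y, - y}"
      by (auto simp: power2_eq_iff)
    then have "card {y \<in> UNIV - {0}. y ^ 2 = s} \<le> card {y, - y}"
      by (rule card_mono[rotated]) simp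
    also have "\<dots> \<le> 2"
      by (simp add: card_insert_if)
    finally show ?thesis .
  qed auto
  have "card (UNIV - {0 :: 'a}) = (\<Sum>s\<in>S. card {y \<in> UNIV - {0}. y ^ 2 = s})"
    using sum_fun_comp[of "UNIV - {0 :: 'a}" S "\<lambda>x. x ^ 2" "\<lambda>_. 1 :: nat"] by (simp add: S_def)
  also have "\<dots> \<le> (\<Sum>s\<in>S. 2)"
    by (intro sum_mono fib)
  finally have "m \<le> card S"
    using card by (simp add: card_Diff_singleton)
  then have "S = {x. x ^ m = 1}"
    using card_power_eq_one_le[OF m, where 'a='a] sub
    by (intro card_subset_eq) (auto dest: card_mono[rotated])
  moreover have "is_square x \<longleftrightarrow> x \<in> S"
    unfolding S_def is_nth_power_def using assms(2) by auto
  ultimately show ?thesis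
    unfolding m_def by blast
qed

text \<open>The quadratic character, extended by 0 at 0.\<close>
definition quadratic_char :: "'a::field \<Rightarrow> complex" where
  "quadratic_char x = (if x = 0 then 0 else if is_square x then 1 else - 1)"

context
  assumes odd_card: "odd CARD('a::{field,finite})"
begin

lemma euler_power_cases:
  fixes x :: 'a
  assumes "x \<noteq> 0"
  shows "x ^ ((CARD('a) - 1) div 2) = 1 \<or> x ^ ((CARD('a) - 1) div 2) = - 1"
proof -
  have "(x ^ ((CARD('a) - 1) div 2)) ^ 2 = 1"
    using finite_field_power_card_minus_one[OF assms] odd_card by (simp flip: power_mult)
  then show ?thesis
    by (simp add: power2_eq_1_iff)
qed

lemma quadratic_char_mult:
  fixes x y :: 'a
  shows "quadratic_char (x * y) = quadratic_char x * quadratic_char y"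
proof (cases "x = 0 \<or> y = 0")
  case False
  define m where "m = (CARD('a) - 1) div 2"
  have char: "quadratic_char z = (if z ^ m = 1 then 1 else - 1)" if "z \<noteq> 0" for z :: 'a
    unfolding quadratic_char_def m_def using that is_square_iff_euler[OF odd_card that] by simp
  have "x ^ m = 1 \<or> x ^ m = - 1" "y ^ m = 1 \<or> y ^ m = - 1"
    using euler_power_cases False unfolding m_def by blast+
  moreover have "(- 1 :: 'a) \<noteq> 1"
    using one_neq_minus_one_if_odd_card[OF odd_card] by metis
  ultimately show ?thesis
    using False char[of x] char[of y] char[of "x * y"]
    by (elim disjE) (simp_all add: power_mult_distrib)
qed (auto simp: quadratic_char_def)

lemma ex_non_square: "\<exists>a :: 'a. \<not> is_square a"
proof (rule ccontr)
  define m where "m = (CARD('a) - 1) div 2"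
  have card: "CARD('a) - 1 = 2 * m"
    unfolding m_def using odd_card by simp
  have m: "0 < m"
    using card card_finite_field_gt_1[where 'a='a] by simp
  assume "\<nexists>a :: 'a. \<not> is_square a"
  then have "UNIV - {0 :: 'a} \<subseteq> {x. x ^ m = 1}"
    unfolding m_def using is_square_iff_euler[OF odd_card] by blast
  then have "card (UNIV - {0 :: 'a}) \<le> card {x :: 'a. x ^ m = 1}"
    by (intro card_mono) auto
  then show False
    using card_power_eq_one_le[OF m, where 'a='a] card m by (simp add: card_Diff_singleton)
qed

lemma quadratic_char_minus_one:
  "quadratic_char (- 1 :: 'a) = (if CARD('a) mod 4 = 1 then 1 else - 1)"
proof -
  have "even ((CARD('a) - 1) div 2) \<longleftrightarrow> CARD('a) mod 4 = 1"
  proof -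
    obtain k where "CARD('a) = 2 * k + 1"
      using odd_card by (elim oddE)
    moreover have "even k \<longleftrightarrow> (2 * k + 1) mod 4 = 1"
      by presburger
    ultimately show ?thesis
      by simp
  qed
  then show ?thesis
    using one_neq_minus_one_if_odd_card[OF odd_card]
    by (auto simp: quadratic_char_def is_square_iff_euler odd_card minus_one_power_iff)
qed

lemma sum_quadratic_char: "(\<Sum>x\<in>UNIV. quadratic_char (x :: 'a)) = 0"
proof -
  obtain a :: 'a where a: "\<not> is_square a"
    using ex_non_square by blast
  then have a0: "a \<noteq> 0"
    by auto
  have "bij (\<lambda>x. a * x)"
    by (rule bij_betwI[where g = "\<lambda>x. x / a"]) (use a0 in auto)
  then show ?thesis
    by (rule sum_eq_0_if_scaled_by_bij[where u = "- 1"])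
      (use a a0 in \<open>auto simp: quadratic_char_mult, auto simp: quadratic_char_def\<close>)
qed

section \<open>Quadratic Gauss sums\<close>

lemma sum_quadratic_char_scaled:
  fixes y :: 'a
  shows "(\<Sum>x\<in>UNIV. quadratic_char x * \<psi> (x * y)) =
    (if y = 0 then 0 else quadratic_char y * (\<Sum>x\<in>UNIV. quadratic_char x * \<psi> x))"
proof (cases "y = 0")
  case True
  then show ?thesis
    by (simp add: sum_quadratic_char flip: sum_distrib_right)
next
  case False
  have bij: "bij (\<lambda>x. x * y)"
    by (rule bij_betwI[where g = "\<lambda>x. x / y"]) (use False in auto)
  have sq: "quadratic_char y * quadratic_char y = 1"
    using False by (simp add: quadratic_char_def)
  have "(\<Sum>x\<in>UNIV. quadratic_char x * \<psi> x) = (\<Sum>x\<in>UNIV. quadratic_char (x * y) * \<psi> (x * y))"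
    using sum.reindex_bij_betw[OF bij, of "\<lambda>x. quadratic_char x * \<psi> x"] by simp
  also have "\<dots> = quadratic_char y * (\<Sum>x\<in>UNIV. quadratic_char x * \<psi> (x * y))"
    by (simp add: quadratic_char_mult sum_distrib_left mult_ac)
  finally show ?thesis
    using False sq by (simp flip: mult.assoc)
qed

text \<open>
  Expand one factor \<open>quadratic_char x * G\<close> as the Gauss sum scaled by \<open>x\<close>; after exchanging the sums,
  orthogonality leaves only the term \<open>t = - 1\<close>.
\<close>
lemma gauss_sum_square:
  fixes \<psi> :: "'a \<Rightarrow> complex"
  assumes "nontrivial_add_char \<psi>"
  shows "(\<Sum>x\<in>UNIV. quadratic_char x * \<psi> x)\<^sup>2 = quadratic_char (- 1 :: 'a) * of_nat CARD('a)"
proof -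
  define G where "G = (\<Sum>x\<in>UNIV. quadratic_char x * \<psi> x)"
  have add: "\<psi> (x + y) = \<psi> x * \<psi> y" for x y
    using assms by (simp add: nontrivial_add_char_def)
  have "G\<^sup>2 = (\<Sum>x\<in>UNIV. (quadratic_char x * G) * \<psi> x)"
    by (simp add: G_def power2_eq_square sum_distrib_right mult_ac)
  also have "\<dots> = (\<Sum>x\<in>UNIV. (\<Sum>t\<in>UNIV. quadratic_char t * \<psi> (t * x)) * \<psi> x)"
    by (intro sum.cong refl) (subst sum_quadratic_char_scaled, auto simp: G_def quadratic_char_def)
  also have "\<dots> = (\<Sum>x\<in>UNIV. \<Sum>t\<in>UNIV. quadratic_char t * \<psi> (x * (t + 1)))"
    by (simp add: sum_distrib_right sum_distrib_left distrib_left add mult_ac)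
  also have "\<dots> = (\<Sum>t\<in>UNIV. quadratic_char t * (\<Sum>x\<in>UNIV. \<psi> (x * (t + 1))))"
    by (subst sum.swap) (simp add: sum_distrib_left)
  also have "\<dots> = (\<Sum>t\<in>UNIV. if t = - 1 then quadratic_char (t :: 'a) * of_nat CARD('a) else 0)"
    unfolding sum_nontrivial_add_char[OF assms]
    by (intro sum.cong refl) (simp add: add_eq_0_iff2)
  finally show ?thesis
    by (simp add: G_def)
qed

text \<open>
  The sign of the Gauss sum depends on the additive character, and a suitable choice of the
  character gives the desired one.
\<close>
lemma ex_add_char_gauss_sum:
  "\<exists>\<psi> :: 'a \<Rightarrow> complex. nontrivial_add_char \<psi> \<and>
    (\<Sum>x\<in>UNIV. quadratic_char x * \<psi> x) = gauss_sign CARD('a) * complex_of_real (sqrt (real CARD('a)))"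
proof -
  define g where "g = gauss_sign CARD('a) * complex_of_real (sqrt (real CARD('a)))"
  obtain \<psi> :: "'a \<Rightarrow> complex" where \<psi>: "nontrivial_add_char \<psi>"
    using ex_nontrivial_add_char by blast
  have "g\<^sup>2 = quadratic_char (- 1 :: 'a) * of_nat CARD('a)"
    by (simp add: g_def gauss_sign_def quadratic_char_minus_one power_mult_distrib flip: of_real_power)
  then have "(\<Sum>x\<in>UNIV. quadratic_char x * \<psi> x)\<^sup>2 = g\<^sup>2"
    by (simp add: gauss_sum_square[OF \<psi>])
  then consider "(\<Sum>x\<in>UNIV. quadratic_char x * \<psi> x) = g"
    | "(\<Sum>x\<in>UNIV. quadratic_char x * \<psi> x) = - g"
    using power2_eq_iff by blast
  then show ?thesis
  proof cases
    case 1
    then show ?thesis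
      using \<psi> g_def by blast
  next
    case 2
    obtain a :: 'a where a: "\<not> is_square a"
      using ex_non_square by blast
    then have a0: "a \<noteq> 0"
      by auto
    have "(\<Sum>x\<in>UNIV. quadratic_char x * \<psi> (a * x)) = g"
      using sum_quadratic_char_scaled[of \<psi> a] a a0 2 by (simp add: quadratic_char_def mult.commute)
    then show ?thesis
      using nontrivial_add_char_scale[OF \<psi> a0] g_def by blast
  qed
qed

end

section \<open>Duality of linear codes\<close>

abbreviation dot :: "'a::field ^ 'n \<Rightarrow> 'a ^ 'n \<Rightarrow> 'a" where
  "dot x y \<equiv> (\<Sum>i\<in>UNIV. x $ i * y $ i)"

lemma subspace_dual_code: "vec.subspace (dual_code C)"
proof (rule vec.subspaceI)
  show "0 \<in> dual_code C"
    by (simp add: dual_code_def)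
next
  fix x y assume "x \<in> dual_code C" "y \<in> dual_code C"
  then show "x + y \<in> dual_code C"
    by (simp add: dual_code_def distrib_left sum.distrib)
next
  fix c x assume x: "x \<in> dual_code C"
  have "dot z (c *s x) = c * dot z x" for z
    unfolding sum_distrib_left by (simp add: mult.left_commute)
  with x show "c *s x \<in> dual_code C"
    by (simp add: dual_code_def)
qed

lemma sum_add_char_subspace:
  fixes \<psi> :: "'a::{field,finite} \<Rightarrow> complex" and D :: "('a ^ 'n) set"
  assumes \<psi>: "nontrivial_add_char \<psi>" and D: "vec.subspace D"
  shows "(\<Sum>y\<in>D. \<psi> (dot y v)) = (if v \<in> dual_code D then of_nat (card D) else 0)"
proof (cases "v \<in> dual_code D")
  case True
  then show ?thesis
    using \<psi> by (simp add: dual_code_def nontrivial_add_char_def)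
next
  case False
  then obtain y where y: "y \<in> D" "dot y v \<noteq> 0"
    unfolding dual_code_def by auto
  obtain t where t: "\<psi> t \<noteq> 1"
    using \<psi> unfolding nontrivial_add_char_def by blast
  define z where "z = (t / dot y v) *s y"
  have z: "z \<in> D"
    unfolding z_def by (intro vec.subspace_scale D y)
  have "dot z v = (t / dot y v) * dot y v"
    unfolding z_def by (simp add: sum_distrib_left mult.assoc)
  then have dz: "dot z v = t"
    using y by simp
  have "bij_betw (\<lambda>x. z + x) D D"
    by (rule bij_betwI[where g = "\<lambda>x. x - z"])
      (auto intro: vec.subspace_add[OF D z] vec.subspace_diff[OF D _ z])
  moreover have "\<psi> (dot (z + x) v) = \<psi> t * \<psi> (dot x v)" for x
    using \<psi> dz by (simp add: distrib_right sum.distrib nontrivial_add_char_def)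
  ultimately show ?thesis
    using sum_eq_0_if_scaled_by_bij[of "\<lambda>x. z + x" D "\<lambda>x. \<psi> (dot x v)" "\<psi> t"] False t by simp
qed

lemma dual_code_UNIV: "dual_code (UNIV :: ('a::field ^ 'n) set) = {0}"
proof -
  have "y $ j = 0" if "y \<in> dual_code UNIV" for y :: "'a ^ 'n" and j
  proof -
    have "dot (axis j 1) y = 0"
      using that by (simp add: dual_code_def)
    moreover have "dot (axis j 1) y = (\<Sum>i\<in>UNIV. if i = j then y $ i else 0)"
      by (intro sum.cong) (auto simp: axis_def)
    ultimately show ?thesis
      by simp
  qed
  then have "y = 0" if "y \<in> dual_code UNIV" for y :: "'a ^ 'n"
    using that by (subst vec_eq_iff) simp
  moreover have "0 \<in> dual_code (UNIV :: ('a ^ 'n) set)"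
    by (rule vec.subspace_0[OF subspace_dual_code])
  ultimately show ?thesis
    by blast
qed

text \<open>Sum \<open>\<psi> (dot c v)\<close> over all codewords \<open>c\<close> and all vectors \<open>v\<close> in both orders.\<close>
lemma card_mult_card_dual_code:
  fixes C :: "('a::{field,finite} ^ 'n) set"
  assumes "vec.subspace C"
  shows "card C * card (dual_code C) = CARD('a ^ 'n)"
proof -
  obtain \<psi> :: "'a \<Rightarrow> complex" where \<psi>: "nontrivial_add_char \<psi>"
    using ex_nontrivial_add_char by blast
  have "of_nat (card C * card (dual_code C)) = (\<Sum>v\<in>UNIV. \<Sum>c\<in>C. \<psi> (dot c v))"
    by (simp add: sum_add_char_subspace[OF \<psi> assms] sum.If_cases)
  also have "\<dots> = (\<Sum>c\<in>C. \<Sum>v\<in>UNIV. \<psi> (dot v c))"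
    by (subst sum.swap) (simp add: mult.commute)
  also have "\<dots> = (\<Sum>c\<in>C. if c = 0 then of_nat CARD('a ^ 'n) else 0)"
    by (intro sum.cong refl, subst sum_add_char_subspace[OF \<psi>]) (simp_all add: dual_code_UNIV)
  also have "\<dots> = of_nat CARD('a ^ 'n)"
    using vec.subspace_0[OF assms] by simp
  finally show ?thesis
    by (simp only: of_nat_eq_iff)
qed

lemma dual_code_dual_code:
  fixes C :: "('a::{field,finite} ^ 'n) set"
  assumes "vec.subspace C"
  shows "dual_code (dual_code C) = C"
proof (rule card_subset_eq[symmetric])
  show "C \<subseteq> dual_code (dual_code C)"
    by (auto simp: dual_code_def mult.commute)
  have "card (dual_code C) * card C = card (dual_code C) * card (dual_code (dual_code C))"
    using card_mult_card_dual_code[OF assms] card_mult_card_dual_code[OF subspace_dual_code, of C]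
    by (simp add: mult.commute)
  moreover have "card (dual_code C) \<noteq> 0"
    using vec.subspace_0[OF subspace_dual_code, of C] by (auto simp: card_eq_0_iff)
  ultimately show "card C = card (dual_code (dual_code C))"
    by simp
qed simp

section \<open>The MacWilliams identity for product weights\<close>

lemma const_poly_0 [simp]: "const_poly 0 = 0"
  and const_poly_1 [simp]: "const_poly 1 = 1"
  and const_poly_add: "const_poly (a + b) = const_poly a + const_poly b"
  and const_poly_mult: "const_poly (a * b) = const_poly a * const_poly b"
  by (simp_all add: const_poly_def single_add mult_single)

lemma const_poly_uminus: "const_poly (- a) = - const_poly a"
  using const_poly_add[of a "- a"] by (simp add: eq_neg_iff_add_eq_0 add.commute)

lemma const_poly_diff: "const_poly (a - b) = const_poly a - const_poly b"
  using const_poly_add[of a "- b"] by (simp add: const_poly_uminus)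

lemma const_poly_sum: "const_poly (sum f A) = (\<Sum>x\<in>A. const_poly (f x))"
  by (induction A rule: infinite_finite_induct) (simp_all add: const_poly_add)

lemma const_poly_prod: "const_poly (prod f A) = (\<Prod>x\<in>A. const_poly (f x))"
  by (induction A rule: infinite_finite_induct) (simp_all add: const_poly_mult)

lemma prod_sum_eq_sum_vec:
  fixes f :: "'n::finite \<Rightarrow> 'a::finite \<Rightarrow> 'r::comm_semiring_1"
  shows "(\<Prod>i\<in>UNIV. \<Sum>x\<in>UNIV. f i x) = (\<Sum>v\<in>UNIV. \<Prod>i\<in>UNIV. f i ((v :: 'a ^ 'n) $ i))"
proof -
  have "bij (vec_nth :: 'a ^ 'n \<Rightarrow> _)"
    by (rule bij_betwI[where g = vec_lambda]) auto
  then show ?thesis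
    using sum.reindex_bij_betw[of vec_nth UNIV UNIV "\<lambda>v. \<Prod>i\<in>UNIV. f i (v i)"]
    by (subst prod_sum_PiE) (auto simp: PiE_UNIV_domain)
qed

lemma nontrivial_add_char_sum:
  assumes "nontrivial_add_char \<psi>"
  shows "\<psi> (sum f A) = (\<Prod>x\<in>A. \<psi> (f x))"
proof -
  have "\<psi> (x + y) = \<psi> x * \<psi> y" and "\<psi> 0 = 1" for x y
    using assms by (simp_all add: nontrivial_add_char_def)
  then show ?thesis
    by (induction A rule: infinite_finite_induct) simp_all
qed

lemma macwilliams_product_weight:
  fixes C :: "('a::{field,finite} ^ 'n) set" and w :: "'a \<Rightarrow> qr_poly"
  assumes \<psi>: "nontrivial_add_char \<psi>" and C: "vec.subspace C"
  shows "(\<Sum>y\<in>dual_code C. \<Prod>i\<in>UNIV. \<Sum>x\<in>UNIV. w x * const_poly (\<psi> (x * y $ i)))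
    = const_poly (of_nat (card (dual_code C))) * (\<Sum>c\<in>C. \<Prod>i\<in>UNIV. w (c $ i))"
proof -
  have "(\<Sum>y\<in>dual_code C. \<Prod>i\<in>UNIV. \<Sum>x\<in>UNIV. w x * const_poly (\<psi> (x * y $ i)))
    = (\<Sum>y\<in>dual_code C. \<Sum>v\<in>UNIV. (\<Prod>i\<in>UNIV. w (v $ i)) * const_poly (\<psi> (dot y v)))"
    by (simp add: prod_sum_eq_sum_vec prod.distrib nontrivial_add_char_sum[OF \<psi>] const_poly_prod
        mult.commute)
  also have "\<dots> = (\<Sum>v\<in>UNIV. (\<Prod>i\<in>UNIV. w (v $ i)) * const_poly (\<Sum>y\<in>dual_code C. \<psi> (dot y v)))"
    by (subst sum.swap) (simp add: const_poly_sum sum_distrib_left)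
  also have "\<dots> = (\<Sum>v\<in>UNIV. if v \<in> C
      then (\<Prod>i\<in>UNIV. w (v $ i)) * const_poly (of_nat (card (dual_code C))) else 0)"
    unfolding sum_add_char_subspace[OF \<psi> subspace_dual_code] dual_code_dual_code[OF C]
    by (intro sum.cong) auto
  also have "\<dots> = (\<Sum>v\<in>C. (\<Prod>i\<in>UNIV. w (v $ i)) * const_poly (of_nat (card (dual_code C))))"
    by (simp add: sum.If_cases)
  finally show ?thesis
    by (simp add: sum_distrib_left mult.commute)
qed

section \<open>The quadratic residue weight enumerator\<close>

text \<open>
  The contribution of a single coordinate with value \<open>x\<close>. The case \<open>x = 0\<close> comes first because 0 is
  itself a square.
\<close>
definition qr_weight :: "'r \<Rightarrow> 'r \<Rightarrow> 'r \<Rightarrow> 'a::field \<Rightarrow> 'r" where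
  "qr_weight X Y Z x = (if x = 0 then X else if is_square x then Y else Z)"

lemma qr_enumerator_eq_sum_prod_weight:
  fixes C :: "('a::field ^ 'n) set"
  shows "qr_enumerator C X Y Z = (\<Sum>c\<in>C. \<Prod>i\<in>UNIV. qr_weight X Y Z (c $ i))"
proof -
  have "X ^ (CARD('n) - hamming_weight c) * Y ^ res_count c * Z ^ nres_count c
    = (\<Prod>i\<in>UNIV. qr_weight X Y Z (c $ i))" for c :: "'a ^ 'n"
  proof -
    have "(\<Prod>i\<in>UNIV. qr_weight X Y Z (c $ i)) =
      (\<Prod>i\<in>UNIV. (if c $ i = 0 then X else 1) * (if c $ i \<noteq> 0 \<and> is_square (c $ i) then Y else 1) *
        (if \<not> is_square (c $ i) then Z else 1))"
      by (intro prod.cong) (auto simp: qr_weight_def)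
    also have "\<dots> = X ^ card {i. c $ i = 0} * Y ^ res_count c * Z ^ nres_count c"
      by (simp add: prod.distrib prod.If_cases res_count_def nres_count_def)
    also have "card {i. c $ i = 0} = CARD('n) - hamming_weight c"
    proof -
      have "{i. c $ i = 0} = UNIV - {i. c $ i \<noteq> 0}"
        by auto
      then show ?thesis
        by (simp only: hamming_weight_def) (simp add: card_Diff_subset)
    qed
    finally show ?thesis ..
  qed
  then show ?thesis
    by (simp add: qr_enumerator_def)
qed

lemma fourier_qr_weight:
  fixes X Y Z :: qr_poly and y :: "'a::{field,finite}"
  assumes odd: "odd CARD('a)" and \<psi>: "nontrivial_add_char \<psi>"
    and g: "(\<Sum>x\<in>UNIV. quadratic_char x * \<psi> x) = g"
  shows "(\<Sum>x\<in>UNIV. qr_weight X Y Z x * const_poly (\<psi> (x * y))) =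
    qr_weight (X + const_poly ((of_nat CARD('a) - 1) / 2) * (Y + Z))
      (X + const_poly (1 / 2) * (- (Y + Z) + const_poly g * (Y - Z)))
      (X + const_poly (1 / 2) * (- (Y + Z) + const_poly g * (Z - Y))) y"
proof -
  define h where "h = const_poly (1 / 2)"
  have h: "h * 2 = 1"
    unfolding h_def mult_2_right by (simp flip: const_poly_add)
  \<comment> \<open>Decompose the weight into the indicator of 0, its complement and the quadratic character.\<close>
  define \<delta> :: "'a \<Rightarrow> complex" where "\<delta> x = (if x = 0 then 1 else 0)" for x
  have "qr_weight X Y Z x = X * const_poly (\<delta> x) + h * (Y + Z) * const_poly (1 - \<delta> x)
      + h * (Y - Z) * const_poly (quadratic_char x)" for x
    by (auto simp: qr_weight_def \<delta>_def quadratic_char_def const_poly_uminus algebra_simps h)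
  then have "(\<Sum>x\<in>UNIV. qr_weight X Y Z x * const_poly (\<psi> (x * y))) =
    X * const_poly (\<Sum>x\<in>UNIV. \<delta> x * \<psi> (x * y))
    + h * (Y + Z) * const_poly (\<Sum>x\<in>UNIV. (1 - \<delta> x) * \<psi> (x * y))
    + h * (Y - Z) * const_poly (\<Sum>x\<in>UNIV. quadratic_char x * \<psi> (x * y))"
    by (simp only: const_poly_sum const_poly_mult sum_distrib_left distrib_right mult.assoc sum.distrib)
  also have d: "(\<Sum>x\<in>UNIV. \<delta> x * \<psi> (x * y)) = 1"
  proof -
    have "(\<Sum>x\<in>UNIV. \<delta> x * \<psi> (x * y)) = (\<Sum>x\<in>UNIV. if x = (0 :: 'a) then 1 else 0)"
      using \<psi> by (intro sum.cong) (auto simp: \<delta>_def nontrivial_add_char_def)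
    then show ?thesis by simp
  qed
  also have "(\<Sum>x\<in>UNIV. (1 - \<delta> x) * \<psi> (x * y)) = (if y = 0 then of_nat CARD('a) else 0) - 1"
    by (simp only: left_diff_distrib sum_subtractf d mult_1_left sum_nontrivial_add_char[OF \<psi>])
  also have "(\<Sum>x\<in>UNIV. quadratic_char x * \<psi> (x * y)) = quadratic_char y * g"
    by (subst sum_quadratic_char_scaled[OF odd]) (simp add: g quadratic_char_def[of y])
  finally have *: "(\<Sum>x\<in>UNIV. qr_weight X Y Z x * const_poly (\<psi> (x * y))) =
    X * const_poly 1 + h * (Y + Z) * const_poly ((if y = 0 then of_nat CARD('a) else 0) - 1)
    + h * (Y - Z) * const_poly (quadratic_char y * g)" .
  have q: "const_poly ((of_nat CARD('a) - 1) / 2) = h * const_poly (of_nat CARD('a) - 1)"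
    unfolding h_def by (simp flip: const_poly_mult)
  show ?thesis
    unfolding * unfolding q h_def[symmetric] qr_weight_def
    by (auto simp: quadratic_char_def const_poly_uminus const_poly_mult const_poly_diff algebra_simps)
qed

theorem theorem5:
  fixes C :: "('a::{field,finite} ^ 'n) set" and q :: nat
  assumes "q = CARD('a)" and "primepow q" and "odd q"
    and "vec.subspace C"
  shows "let X = var_poly VarX; Y = var_poly VarY; Z = var_poly VarZ;
             s = const_poly (gauss_sign q * complex_of_real (sqrt (real q)));
             X' = X + const_poly ((of_nat q - 1) / 2) * (Y + Z);
             Y' = X + const_poly (1 / 2) * (- (Y + Z) + s * (Y - Z));
             Z' = X + const_poly (1 / 2) * (- (Y + Z) + s * (Z - Y))
         in qr_enumerator C X Y Z =
              const_poly (1 / of_nat (card (dual_code C))) * qr_enumerator (dual_code C) X' Y' Z'"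
proof -
  have odd: "odd CARD('a)"
    using assms by simp
  obtain \<psi> :: "'a \<Rightarrow> complex" where \<psi>: "nontrivial_add_char \<psi>"
    and g: "(\<Sum>x\<in>UNIV. quadratic_char x * \<psi> x) = gauss_sign q * complex_of_real (sqrt (real q))"
    using ex_add_char_gauss_sum[OF odd] assms(1) by blast
  have "card (dual_code C) \<noteq> 0"
    using vec.subspace_0[OF subspace_dual_code, of C] by (auto simp: card_eq_0_iff)
  then have inv: "const_poly (1 / of_nat (card (dual_code C))) *
      (const_poly (of_nat (card (dual_code C))) * P) = P" for P
    by (simp flip: mult.assoc const_poly_mult)
  show ?thesis
    unfolding Let_def qr_enumerator_eq_sum_prod_weight
    unfolding assms(1) fourier_qr_weight[OF odd \<psi> g, unfolded assms(1), symmetric]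
      macwilliams_product_weight[OF \<psi> assms(4)] inv ..
qed

end
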